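(* Let $Z$ be the centered Gaussian process defined in the context, arising as the limit of the quenched-centered current of independent particles on $\mathbb{Z}$ in an i.i.d. space-time environment satisfying (A1)–(A3) with initial distribution satisfying (B1)–(B2). Suppose that $\sigma_0^2=\rho_0$; this holds in particular if, given $\omega$, the initial occupation variables $\eta_0$ have distribution $\mu^{\rho_0,\omega}$ (independent Poisson variables with means $\rho_0f(T_{x,0}\omega)$, $x\in\mathbb{Z}$). Then the process $Z(t,0)$, $t\ge0$, has covariance $$\mathbf{E}[Z(s,0)Z(t,0)]=\frac{\rho_0\sigma}{\sqrt{2\pi}}\bigl(\sqrt s+\sqrt t-\sqrt{|t-s|}\,\bigr),$$ i.e. (when $\rho_0>0$) $\bigl(\rho_0^{-1}\sigma^{-1}\sqrt{\pi/2}\bigr)^{1/2}Z(t,0)$ is a fractional Brownian motion with Hurst parameter $1/4$.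
   Context: Environment (dimension $d=1$). Fix a finite constant $R$. An environment is $\omega=(\omega_{x,s})_{(x,s)\in\mathbb{Z}\times\mathbb{Z}}$ where each $\omega_{x,s}=(\omega_{x,s}(z):z\in\mathbb{Z},|z|\le R)$ is a probability vector; $(T_{x,s}\omega)_{y,t}=\omega_{x+y,s+t}$; $\pi^\omega_{s,s+1}(x,y)=\omega_{x,s}(y-x)$ and $\pi^\omega_{s,t}$ are the composed multistep transition probabilities. $\mathbb{P}$ is a probability measure on environments, with expectation $\mathbb{E}$; $p(u)=\mathbb{E}[\omega_{0,0}(u)]$. (A1) The vectors $(\omega_{x,s})$ are i.i.d. under $\mathbb{P}$. (A2) $\mathbb{P}\{\exists z: 0<\omega_{0,0}(z)<1\}>0$. (A3) There do not exist $x\in\mathbb{Z}$ and an additive subgroup $\mathbb{G}\subsetneq\mathbb{Z}$ with $\sum_{z\in\mathbb{G}}p(x+z)=1$. Initial distribution. (B1) Given $\omega$, $\eta_0=(\eta_0(x))_{x\in\mathbb{Z}}$ has distribution $\mu^\omega=\bigotimes_x\mu^\omega_x$, where $\mu_x^\omega$ depends measurably only on $(\omega_{y,s}:s\le-1)$ and $\mu^\omega_x=\mu_0^{T_{x,0}\omega}$. (B2) $E[\eta_0(0)^2]<\infty$, where $E$ averages over $\eta_0$ and $\omega$; $\mathrm{Var}^\omega$ is variance under $\mu^\omega$. Density: $f=\lim_{N\to\infty}f_N$ $\mathbb{P}$-a.s., where $f_N(\omega)=\sum_{z\in\mathbb{Z}}\pi^\omega_{-N,0}(z,0)$; $\mathbb{E}f=1$,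 $\mathbb{E}(f^2)<\infty$. Parameters: $v=\sum_xxp(x)$, $\sigma^2=\sum_xx^2p(x)-v^2$, $\sigma>0$, $\rho_0=E[\eta_0(x)]$, $\sigma_0^2=\mathbb{E}[\mathrm{Var}^\omega(\eta_0(0))]$. Process $Z$. Let $\varphi_{\nu^2}(x)=(2\pi\nu^2)^{-1/2}e^{-x^2/(2\nu^2)}$, $\Phi_{\nu^2}(x)=\int_{-\infty}^x\varphi_{\nu^2}(y)\,dy$, $\Psi_{\nu^2}(x)=\nu^2\varphi_{\nu^2}(x)-x(1-\Phi_{\nu^2}(x))$ for $\nu>0$, $\Psi_0(x)=\max(-x,0)$. $Z=\{Z(t,r):t\in\mathbb{R}_+,r\in\mathbb{R}\}$ is the mean-zero Gaussian process with covariance $\mathbf{E}[Z(s,q)Z(t,r)]=\rho_0\Gamma_1+\sigma_0^2\Gamma_2$, where $\Gamma_1((s,q),(t,r))=\Psi_{\sigma^2(t+s)}(r-q)-\Psi_{\sigma^2|t-s|}(r-q)$ and $\Gamma_2((s,q),(t,r))=\Psi_{\sigma^2s}(-q)+\Psi_{\sigma^2t}(r)-\Psi_{\sigma^2(t+s)}(r-q)$. Fractional Brownian motion with Hurst parameter $1/4$ is the centered Gaussian process with covariance $\frac12(\sqrt s+\sqrt t-\sqrt{|t-s|})$. *)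

theory Defs
  imports "HOL-Probability.Probability" "HOL-Algebra.Elementary_Groups"
begin

section \<open>Space-time environments on the integers\<close>

text \<open>An environment assigns to each space-time point \<open>(x, s)\<close> the law of the jump made
  there. Vectors indexed by \<open>{z. \<bar>z\<bar> \<le> R}\<close> are represented by probability mass functions on
  the integers whose support lies in that set.\<close>

type_synonym environment = "int \<times> int \<Rightarrow> int pmf"

definition site_space :: "nat \<Rightarrow> int pmf measure" where
  "site_space R =
     vimage_algebra {q. set_pmf q \<subseteq> {z. \<bar>z\<bar> \<le> int R}} pmf (\<Pi>\<^sub>M z\<in>(UNIV :: int set). (borel :: real measure))"

definition env_space :: "nat \<Rightarrow> environment measure" where
  "env_space R = (\<Pi>\<^sub>M a\<in>(UNIV :: (int \<times> int) set). site_space R)"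

definition env_shift :: "int \<Rightarrow> int \<Rightarrow> environment \<Rightarrow> environment" where
  "env_shift x s \<omega> = (\<lambda>(y, t). \<omega> (x + y, s + t))"

definition env_measure :: "nat \<Rightarrow> environment measure \<Rightarrow> bool" where
  "env_measure R P \<longleftrightarrow> prob_space P \<and> sets P = sets (env_space R)"

definition mean_jump :: "environment measure \<Rightarrow> int \<Rightarrow> real" where
  "mean_jump P u = (\<integral>\<omega>. pmf (\<omega> (0, 0)) u \<partial>P)"

definition A1 :: "nat \<Rightarrow> environment measure \<Rightarrow> bool" where
  "A1 R P \<longleftrightarrow>
     prob_space.indep_vars P (\<lambda>_. site_space R) (\<lambda>a \<omega>. \<omega> a) (UNIV :: (int \<times> int) set) \<and>
     (\<forall>a. distr P (site_space R) (\<lambda>\<omega>. \<omega> a) = distr P (site_space R) (\<lambda>\<omega>. \<omega> (0, 0)))"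

definition A2 :: "environment measure \<Rightarrow> bool" where
  "A2 P \<longleftrightarrow> measure P {\<omega> \<in> space P. \<exists>z. 0 < pmf (\<omega> (0, 0)) z \<and> pmf (\<omega> (0, 0)) z < 1} > 0"

definition A3 :: "environment measure \<Rightarrow> bool" where
  "A3 P \<longleftrightarrow>
     \<not> (\<exists>x G. subgroup G integer_group \<and> G \<noteq> UNIV \<and> (\<Sum>\<^sub>\<infinity>z\<in>G. mean_jump P (x + z)) = 1)"


section \<open>Quenched walks and the density \<open>f\<close>\<close>

definition quenched_step :: "environment \<Rightarrow> int \<Rightarrow> int \<Rightarrow> int pmf" where
  "quenched_step \<omega> s x = map_pmf (\<lambda>z. x + z) (\<omega> (x, s))"

primrec quenched_walk :: "environment \<Rightarrow> int \<Rightarrow> int \<Rightarrow> nat \<Rightarrow> int pmf" where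
  "quenched_walk \<omega> s x 0 = return_pmf x"
| "quenched_walk \<omega> s x (Suc n) = bind_pmf (quenched_walk \<omega> s x n) (quenched_step \<omega> (s + int n))"

text \<open>\<open>transition \<omega> s t x y\<close> is $\pi^\omega_{s,t}(x,y)$, meant for \<open>s \<le> t\<close>.\<close>

definition transition :: "environment \<Rightarrow> int \<Rightarrow> int \<Rightarrow> int \<Rightarrow> int \<Rightarrow> real" where
  "transition \<omega> s t x y = pmf (quenched_walk \<omega> s x (nat (t - s))) y"

definition density_approx :: "nat \<Rightarrow> environment \<Rightarrow> real" where
  "density_approx N \<omega> = (\<Sum>\<^sub>\<infinity>z\<in>UNIV. transition \<omega> (- int N) 0 z 0)"

text \<open>The limit exists for almost every environment; on the exceptional null set the value of
  \<open>lim\<close> is unspecified.\<close>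

definition env_density :: "environment \<Rightarrow> real" where
  "env_density \<omega> = lim (\<lambda>N. density_approx N \<omega>)"


section \<open>Initial occupation variables\<close>

text \<open>\<open>\<mu> \<omega> x\<close> is the law of the number of particles at \<open>x\<close> at time \<open>0\<close>, given \<open>\<omega>\<close>.\<close>

definition occupation_law :: "(environment \<Rightarrow> int \<Rightarrow> nat pmf) \<Rightarrow> environment \<Rightarrow> (int \<Rightarrow> nat) measure" where
  "occupation_law \<mu> \<omega> = (\<Pi>\<^sub>M x\<in>(UNIV :: int set). measure_pmf (\<mu> \<omega> x))"

text \<open>The \<open>\<sigma>\<close>-algebra generated by the levels \<open>s \<le> -1\<close> of the environment.\<close>

definition past_space :: "nat \<Rightarrow> environment measure" where
  "past_space R =
     vimage_algebra (space (env_space R)) (\<lambda>\<omega>. restrict \<omega> (UNIV \<times> {..-1}))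
       (\<Pi>\<^sub>M a\<in>UNIV \<times> {..-1}. site_space R)"

definition B1 :: "nat \<Rightarrow> (environment \<Rightarrow> int \<Rightarrow> nat pmf) \<Rightarrow> bool" where
  "B1 R \<mu> \<longleftrightarrow>
     (\<forall>x. (\<lambda>\<omega>. measure_pmf (\<mu> \<omega> x)) \<in> past_space R \<rightarrow>\<^sub>M prob_algebra (count_space UNIV)) \<and>
     (\<forall>\<omega>\<in>space (env_space R). \<forall>x. \<mu> \<omega> x = \<mu> (env_shift x 0 \<omega>) 0)"

definition B2 :: "environment measure \<Rightarrow> (environment \<Rightarrow> int \<Rightarrow> nat pmf) \<Rightarrow> bool" where
  "B2 P \<mu> \<longleftrightarrow> (\<integral>\<^sup>+\<omega>. (\<integral>\<^sup>+\<eta>. ennreal ((real (\<eta> 0))\<^sup>2) \<partial>occupation_law \<mu> \<omega>) \<partial>P) < \<infinity>"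

definition quenched_mean :: "(environment \<Rightarrow> int \<Rightarrow> nat pmf) \<Rightarrow> environment \<Rightarrow> real" where
  "quenched_mean \<mu> \<omega> = (\<integral>\<eta>. real (\<eta> 0) \<partial>occupation_law \<mu> \<omega>)"

definition quenched_var :: "(environment \<Rightarrow> int \<Rightarrow> nat pmf) \<Rightarrow> environment \<Rightarrow> real" where
  "quenched_var \<mu> \<omega> = (\<integral>\<eta>. (real (\<eta> 0) - quenched_mean \<mu> \<omega>)\<^sup>2 \<partial>occupation_law \<mu> \<omega>)"

text \<open>\<open>poisson_pmf\<close> is only meaningful for positive rates, whereas \<open>env_density\<close> may vanish;
  the Poisson law with mean \<open>0\<close> is the point mass at \<open>0\<close>.\<close>

definition poisson_law :: "real \<Rightarrow> nat pmf" where
  "poisson_law r = (if 0 < r then poisson_pmf r else return_pmf 0)"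

definition poisson_occupation_law :: "real \<Rightarrow> environment \<Rightarrow> (int \<Rightarrow> nat) measure" where
  "poisson_occupation_law \<rho> \<omega> =
     (\<Pi>\<^sub>M x\<in>(UNIV :: int set). measure_pmf (poisson_law (\<rho> * env_density (env_shift x 0 \<omega>))))"


section \<open>Parameters\<close>

definition velocity :: "environment measure \<Rightarrow> real" where
  "velocity P = (\<Sum>\<^sub>\<infinity>x\<in>UNIV. real_of_int x * mean_jump P x)"

definition walk_sigma :: "environment measure \<Rightarrow> real" where
  "walk_sigma P = sqrt ((\<Sum>\<^sub>\<infinity>x\<in>UNIV. (real_of_int x)\<^sup>2 * mean_jump P x) - (velocity P)\<^sup>2)"

text \<open>By shift invariance the site used in the next two definitions is immaterial.\<close>

definition rho0 :: "environment measure \<Rightarrow> (environment \<Rightarrow> int \<Rightarrow> nat pmf) \<Rightarrow> real" where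
  "rho0 P \<mu> = (\<integral>\<omega>. quenched_mean \<mu> \<omega> \<partial>P)"

definition sigma0_sq :: "environment measure \<Rightarrow> (environment \<Rightarrow> int \<Rightarrow> nat pmf) \<Rightarrow> real" where
  "sigma0_sq P \<mu> = (\<integral>\<omega>. quenched_var \<mu> \<omega> \<partial>P)"


section \<open>Gaussian processes\<close>

text \<open>Degenerate (constant) Gaussian variables are allowed.\<close>

definition gaussian_law :: "real \<Rightarrow> real \<Rightarrow> real measure" where
  "gaussian_law m s = (if s = 0 then return borel m else density lborel (normal_density m s))"

definition gaussian_process :: "'w measure \<Rightarrow> 'i set \<Rightarrow> ('i \<Rightarrow> 'w \<Rightarrow> real) \<Rightarrow> bool" where
  "gaussian_process M T X \<longleftrightarrow>
     prob_space M \<and> (\<forall>i\<in>T. X i \<in> borel_measurable M) \<and>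
     (\<forall>F c. finite F \<and> F \<subseteq> T \<longrightarrow>
        (\<exists>m s. 0 \<le> s \<and> distr M borel (\<lambda>w. \<Sum>i\<in>F. c i * X i w) = gaussian_law m s))"

definition centered_gaussian_process ::
  "'w measure \<Rightarrow> 'i set \<Rightarrow> ('i \<Rightarrow> 'i \<Rightarrow> real) \<Rightarrow> ('i \<Rightarrow> 'w \<Rightarrow> real) \<Rightarrow> bool" where
  "centered_gaussian_process M T K X \<longleftrightarrow>
     gaussian_process M T X \<and>
     (\<forall>i\<in>T. (\<integral>w. X i w \<partial>M) = 0) \<and>
     (\<forall>i\<in>T. \<forall>j\<in>T. (\<integral>w. X i w * X j w \<partial>M) = K i j)"

definition fractional_brownian_motion :: "real \<Rightarrow> 'w measure \<Rightarrow> (real \<Rightarrow> 'w \<Rightarrow> real) \<Rightarrow> bool" where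
  "fractional_brownian_motion H M B \<longleftrightarrow>
     centered_gaussian_process M {0..}
       (\<lambda>s t. (s powr (2 * H) + t powr (2 * H) - \<bar>t - s\<bar> powr (2 * H)) / 2) B"


section \<open>The covariance of the limit process\<close>

text \<open>The parameter \<open>a\<close> is the variance $\nu^2$.\<close>

definition gauss_phi :: "real \<Rightarrow> real \<Rightarrow> real" where
  "gauss_phi a x = normal_density 0 (sqrt a) x"

definition gauss_Phi :: "real \<Rightarrow> real \<Rightarrow> real" where
  "gauss_Phi a x = (LINT y:{..x}|lborel. gauss_phi a y)"

definition gauss_Psi :: "real \<Rightarrow> real \<Rightarrow> real" where
  "gauss_Psi a x = (if a = 0 then max (- x) 0 else a * gauss_phi a x - x * (1 - gauss_Phi a x))"

definition Gamma1 :: "real \<Rightarrow> real \<times> real \<Rightarrow> real \<times> real \<Rightarrow> real" where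
  "Gamma1 \<sigma> = (\<lambda>(s, q) (t, r). gauss_Psi (\<sigma>\<^sup>2 * (t + s)) (r - q) - gauss_Psi (\<sigma>\<^sup>2 * \<bar>t - s\<bar>) (r - q))"

definition Gamma2 :: "real \<Rightarrow> real \<times> real \<Rightarrow> real \<times> real \<Rightarrow> real" where
  "Gamma2 \<sigma> = (\<lambda>(s, q) (t, r).
     gauss_Psi (\<sigma>\<^sup>2 * s) (- q) + gauss_Psi (\<sigma>\<^sup>2 * t) r - gauss_Psi (\<sigma>\<^sup>2 * (t + s)) (r - q))"

text \<open>Here \<open>\<rho>\<close> and \<open>\<kappa>\<close> stand for $\rho_0$ and $\sigma_0^2$.\<close>

definition current_covariance ::
  "real \<Rightarrow> real \<Rightarrow> real \<Rightarrow> real \<times> real \<Rightarrow> real \<times> real \<Rightarrow> real" where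
  "current_covariance \<rho> \<kappa> \<sigma> a b = \<rho> * Gamma1 \<sigma> a b + \<kappa> * Gamma2 \<sigma> a b"

end

theory Submission
  imports Defs
begin

text \<open>The first claim holds because a Poisson variable has equal mean and variance. When the
  occupation variables are quenched Poisson with means \<open>\<rho> f(T\<^sub>x \<omega>)\<close>, the quenched variance and
  the quenched mean at the origin coincide for almost every environment, whatever value the density
  takes, so their averages \<open>\<sigma>\<^sub>0\<^sup>2\<close> and \<open>\<rho>\<^sub>0\<close> coincide (\<open>sigma0_sq_eq_rho0_if_poisson\<close>).

  The covariance formula is a cancellation. If \<open>\<sigma>\<^sub>0\<^sup>2 = \<rho>\<^sub>0\<close>, the terms with variance parameter
  \<open>\<sigma>\<^sup>2 (t + s)\<close> occur in \<open>\<Gamma>\<^sub>1\<close> and \<open>\<Gamma>\<^sub>2\<close> with opposite signs and disappear, so at \<open>q = r = 0\<close>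
  only the three values \<open>\<Psi>(0)\<close> with variance parameters \<open>\<sigma>\<^sup>2 s\<close>, \<open>\<sigma>\<^sup>2 t\<close> and \<open>\<sigma>\<^sup>2 \<bar>t - s\<bar>\<close> remain.
  Each is proportional to the square root of its parameter (\<open>gauss_Psi_at_0\<close>), which gives
  the covariance of a multiple of fractional Brownian motion (\<open>current_covariance_equal_parameters\<close>).
  Fixing the spatial parameter and rescaling preserves Gaussianity
  (\<open>centered_gaussian_process_reindex_scale\<close>).

  The identity \<open>\<surd>(\<sigma>\<^sup>2) = \<sigma>\<close> needs \<open>\<sigma> \<ge> 0\<close>, and the normalisation by \<open>1/\<sigma>\<close> needs \<open>\<sigma> > 0\<close>.
  Positivity is a consequence of irreducibility: if \<open>\<sigma>\<close> were zero, the averaged jump would be deterministic,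
  and the trivial subgroup would violate (A3) (\<open>walk_sigma_pos\<close>).\<close>

section \<open>Poisson occupation variables\<close>

text \<open>The Stein identity for the Poisson law, which comes from \<open>(n + 1) p(n + 1) = r p(n)\<close>. With
  \<open>g = 1\<close> and \<open>g(n) = n\<close> it yields the first two moments; phrased for nonnegative integrals it
  yields their finiteness at the same time.\<close>

lemma nn_integral_poisson_shift:
  fixes g :: "nat \<Rightarrow> ennreal"
  assumes "0 < r"
  shows "(\<integral>\<^sup>+n. ennreal (real n) * g n \<partial>poisson_pmf r) = ennreal r * (\<integral>\<^sup>+n. g (Suc n) \<partial>poisson_pmf r)"
proof -
  let ?p = "pmf (poisson_pmf r)"
  have rec: "ennreal (?p (Suc n)) * ennreal (real (Suc n)) = ennreal r * ennreal (?p n)" for n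
  proof -
    have "?p (Suc n) * real (Suc n) = r * ?p n"
      using assms by (simp add: field_simps del: of_nat_Suc)
    then show ?thesis
      using assms by (simp flip: ennreal_mult del: of_nat_Suc pmf_poisson)
  qed
  have "(\<integral>\<^sup>+n. ennreal (real n) * g n \<partial>poisson_pmf r)
      = (\<Sum>n. ennreal (?p n) * (ennreal (real n) * g n))"
    by (simp only: nn_integral_measure_pmf nn_integral_count_space_nat)
  also have "\<dots> = (\<Sum>n. ennreal (?p (Suc n)) * (ennreal (real (Suc n)) * g (Suc n)))"
    using suminf_offset[of "\<lambda>n. ennreal (?p n) * (ennreal (real n) * g n)" 1]
    by (simp del: of_nat_Suc pmf_poisson)
  also have "\<dots> = (\<Sum>n. ennreal r * (ennreal (?p n) * g (Suc n)))"
    by (simp only: rec mult.assoc[symmetric])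
  also have "\<dots> = ennreal r * (\<integral>\<^sup>+n. g (Suc n) \<partial>poisson_pmf r)"
    by (simp only: nn_integral_measure_pmf nn_integral_count_space_nat ennreal_suminf_cmult)
  finally show ?thesis .
qed

lemma poisson_mean_and_variance:
  assumes "0 < r"
  shows "measure_pmf.expectation (poisson_pmf r) real = r"
    and "measure_pmf.variance (poisson_pmf r) real = r"
proof -
  have first: "(\<integral>\<^sup>+n. ennreal (real n) \<partial>poisson_pmf r) = ennreal r"
    using nn_integral_poisson_shift[OF assms, of "\<lambda>_. 1"] by simp
  have second: "(\<integral>\<^sup>+n. ennreal ((real n)\<^sup>2) \<partial>poisson_pmf r) = ennreal (r\<^sup>2 + r)"
  proof -
    have "(\<integral>\<^sup>+n. ennreal ((real n)\<^sup>2) \<partial>poisson_pmf r)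
        = (\<integral>\<^sup>+n. ennreal (real n) * ennreal (real n) \<partial>poisson_pmf r)"
      by (simp add: power2_eq_square ennreal_mult)
    also have "\<dots> = ennreal r * (\<integral>\<^sup>+n. ennreal (real n) + 1 \<partial>poisson_pmf r)"
      by (subst nn_integral_poisson_shift[OF assms]) (simp add: ennreal_plus add.commute flip: ennreal_1)
    also have "\<dots> = ennreal r * (ennreal r + 1)"
      by (simp add: nn_integral_add first)
    also have "\<dots> = ennreal (r\<^sup>2 + r)"
      using assms by (simp add: power2_eq_square ennreal_mult ennreal_plus distrib_left)
    finally show ?thesis .
  qed
  have int1: "integrable (poisson_pmf r) real"
    by (rule integrableI_nonneg) (auto simp: first)
  have int2: "integrable (poisson_pmf r) (\<lambda>n. (real n)\<^sup>2)"
    by (rule integrableI_nonneg) (auto simp: second)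
  show mean: "measure_pmf.expectation (poisson_pmf r) real = r"
    using assms by (subst integral_eq_nn_integral) (auto simp: first)
  have "measure_pmf.expectation (poisson_pmf r) (\<lambda>n. (real n)\<^sup>2) = r\<^sup>2 + r"
    using assms by (subst integral_eq_nn_integral) (auto simp: second simp del: ennreal_plus)
  then show "measure_pmf.variance (poisson_pmf r) real = r"
    using measure_pmf.variance_eq[OF int1 int2] mean by simp
qed

text \<open>A nonpositive rate gives the point mass at \<open>0\<close>, whose mean and variance both vanish,
  so the identity extends from the Poisson laws to every real rate.\<close>

lemma poisson_law_variance_eq_mean:
  "measure_pmf.variance (poisson_law r) real = measure_pmf.expectation (poisson_law r) real"
  using poisson_mean_and_variance by (simp add: poisson_law_def)

lemma integral_occupation_law:
  fixes g :: "nat \<Rightarrow> real"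
  shows "(\<integral>\<eta>. g (\<eta> x) \<partial>(\<Pi>\<^sub>M x\<in>(UNIV :: int set). measure_pmf (\<nu> x))) = measure_pmf.expectation (\<nu> x) g"
proof -
  have "measure_pmf (\<nu> x) = distr (\<Pi>\<^sub>M x\<in>(UNIV :: int set). measure_pmf (\<nu> x)) (measure_pmf (\<nu> x)) (\<lambda>\<eta>. \<eta> x)"
    by (rule distr_PiM_component[symmetric]) (auto intro: measure_pmf.prob_space_axioms)
  then have "measure_pmf.expectation (\<nu> x) g
      = integral\<^sup>L (distr (\<Pi>\<^sub>M x\<in>(UNIV :: int set). measure_pmf (\<nu> x)) (measure_pmf (\<nu> x)) (\<lambda>\<eta>. \<eta> x)) g"
    by simp
  also have "\<dots> = (\<integral>\<eta>. g (\<eta> x) \<partial>(\<Pi>\<^sub>M x\<in>(UNIV :: int set). measure_pmf (\<nu> x)))"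
    by (rule integral_distr) (auto intro: measurable_component_singleton)
  finally show ?thesis by simp
qed

lemma quenched_mean_eq: "quenched_mean \<mu> \<omega> = measure_pmf.expectation (\<mu> \<omega> 0) real"
  by (simp add: quenched_mean_def occupation_law_def integral_occupation_law)

lemma quenched_var_eq: "quenched_var \<mu> \<omega> = measure_pmf.variance (\<mu> \<omega> 0) real"
  unfolding quenched_var_def quenched_mean_eq occupation_law_def
  by (rule integral_occupation_law)

text \<open>For a fixed environment the Poisson occupation law is the occupation law of another family
  \<open>\<mu>'\<close> of site laws, and the quenched moments depend on the family only through the occupation law.\<close>

lemma quenched_var_eq_mean_if_poisson:
  assumes "occupation_law \<mu> \<omega> = poisson_occupation_law \<rho> \<omega>"
  shows "quenched_var \<mu> \<omega> = quenched_mean \<mu> \<omega>"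
proof -
  let ?\<mu>' = "\<lambda>\<omega> x. poisson_law (\<rho> * env_density (env_shift x 0 \<omega>))"
  have law: "occupation_law \<mu> \<omega> = occupation_law ?\<mu>' \<omega>"
    using assms by (simp add: occupation_law_def poisson_occupation_law_def)
  have "quenched_mean \<mu> \<omega> = quenched_mean ?\<mu>' \<omega>"
    by (simp add: quenched_mean_def law)
  moreover have "quenched_var \<mu> \<omega> = quenched_var ?\<mu>' \<omega>"
    using calculation by (simp add: quenched_var_def law)
  ultimately show ?thesis
    by (simp add: quenched_mean_eq quenched_var_eq poisson_law_variance_eq_mean)
qed

lemma sets_past_space_subset: "sets (past_space R) \<subseteq> sets (env_space R)"
  unfolding past_space_def env_space_def
  by (rule sets_image_in_sets) (auto intro: measurable_restrict_subset)

lemma occupation_law_measurable: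
  assumes "env_measure R P" "B1 R \<mu>"
  shows "(\<lambda>\<omega>. measure_pmf (\<mu> \<omega> x)) \<in> P \<rightarrow>\<^sub>M subprob_algebra (count_space UNIV)"
proof -
  have sets_P: "sets P = sets (env_space R)"
    using assms by (simp add: env_measure_def)
  have "(\<lambda>\<omega>. measure_pmf (\<mu> \<omega> x)) \<in> past_space R \<rightarrow>\<^sub>M subprob_algebra (count_space UNIV)"
    using assms by (auto simp: B1_def intro: measurable_prob_algebraD)
  moreover have "space (past_space R) = space P"
    using sets_eq_imp_space_eq[OF sets_P] by (simp add: past_space_def)
  ultimately show ?thesis
    using measurable_mono[of "subprob_algebra (count_space UNIV)" "subprob_algebra (count_space UNIV)" "past_space R" P]
      sets_past_space_subset[of R] sets_P by auto
qed

text \<open>Equality of two Bochner integrals from almost everywhere equality of the integrands requires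
  the integrands to be measurable. Written as nonnegative integrals against the kernel
  \<open>\<omega> \<mapsto> \<mu> \<omega> 0\<close>, both moments inherit measurability from that kernel.\<close>

lemma quenched_moments_measurable:
  assumes "env_measure R P" "B1 R \<mu>"
  shows "quenched_mean \<mu> \<in> borel_measurable P"
    and "quenched_var \<mu> \<in> borel_measurable P"
proof -
  note law [measurable] = occupation_law_measurable[OF assms, of 0]
  have mean_eq: "quenched_mean \<mu> = (\<lambda>\<omega>. enn2real (\<integral>\<^sup>+n. ennreal (real n) \<partial>\<mu> \<omega> 0))"
    by (rule ext, unfold quenched_mean_eq, rule integral_eq_nn_integral) auto
  show mean [measurable]: "quenched_mean \<mu> \<in> borel_measurable P"
    unfolding mean_eq
    by (intro borel_measurable_enn2real nn_integral_measurable_subprob_algebra2[OF _ law])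
      measurable
  have var_eq: "quenched_var \<mu> = (\<lambda>\<omega>. enn2real (\<integral>\<^sup>+n. ennreal ((real n - quenched_mean \<mu> \<omega>)\<^sup>2) \<partial>\<mu> \<omega> 0))"
    by (rule ext, unfold quenched_var_eq quenched_mean_eq, rule integral_eq_nn_integral) auto
  show "quenched_var \<mu> \<in> borel_measurable P"
    unfolding var_eq
    by (intro borel_measurable_enn2real nn_integral_measurable_subprob_algebra2[OF _ law])
      measurable
qed

lemma sigma0_sq_eq_rho0_if_poisson:
  assumes "env_measure R P" "B1 R \<mu>"
    and "AE \<omega> in P. occupation_law \<mu> \<omega> = poisson_occupation_law \<rho> \<omega>"
  shows "sigma0_sq P \<mu> = rho0 P \<mu>"
  unfolding sigma0_sq_def rho0_def
proof (rule integral_cong_AE)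
  show "AE \<omega> in P. quenched_var \<mu> \<omega> = quenched_mean \<mu> \<omega>"
    using assms(3) by eventually_elim (rule quenched_var_eq_mean_if_poisson)
qed (use quenched_moments_measurable[OF assms(1,2)] in auto)


section \<open>The averaged walk is nondegenerate\<close>

lemma pmf_site_measurable:
  assumes "env_measure R P"
  shows "(\<lambda>\<omega>. pmf (\<omega> a) u) \<in> borel_measurable P"
proof -
  have "pmf \<in> site_space R \<rightarrow>\<^sub>M (\<Pi>\<^sub>M z\<in>(UNIV :: int set). (borel :: real measure))"
    unfolding site_space_def by (rule measurable_vimage_algebra1) (auto simp: space_PiM)
  then have "(\<lambda>q. pmf q u) \<in> borel_measurable (site_space R)"
    by (rule measurable_compose) (rule measurable_component_singleton, simp)
  moreover have "(\<lambda>\<omega>. \<omega> a) \<in> env_space R \<rightarrow>\<^sub>M site_space R"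
    unfolding env_space_def by (rule measurable_component_singleton) simp
  ultimately have "(\<lambda>\<omega>. pmf (\<omega> a) u) \<in> borel_measurable (env_space R)"
    by (rule measurable_compose[rotated])
  then show ?thesis
    using assms by (auto simp: env_measure_def cong: measurable_cong_sets)
qed

lemma site_support:
  assumes "env_measure R P" "\<omega> \<in> space P"
  shows "set_pmf (\<omega> a) \<subseteq> {- int R..int R}"
proof -
  have "\<omega> \<in> space (env_space R)"
    using assms sets_eq_imp_space_eq[of P "env_space R"] by (simp add: env_measure_def)
  then have "set_pmf (\<omega> a) \<subseteq> {z. \<bar>z\<bar> \<le> int R}"
    by (cases a) (simp add: env_space_def site_space_def space_PiM PiE_iff)
  then show ?thesis
    by (force simp: abs_le_iff)
qed

lemma mean_jump_eq_0:
  assumes "env_measure R P" "u \<notin> {- int R..int R}"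
  shows "mean_jump P u = 0"
proof -
  have "pmf (\<omega> (0, 0)) u = 0" if "\<omega> \<in> space P" for \<omega>
    using site_support[OF assms(1) that, of "(0, 0)"] assms(2) by (auto simp: pmf_eq_0_set_pmf)
  then have "mean_jump P u = (\<integral>\<omega>. 0 \<partial>P)"
    unfolding mean_jump_def by (intro Bochner_Integration.integral_cong) auto
  then show ?thesis by simp
qed

lemma mean_jump_nonneg: "0 \<le> mean_jump P u"
  unfolding mean_jump_def by (rule Bochner_Integration.integral_nonneg) simp

lemma sum_mean_jump:
  assumes "env_measure R P"
  shows "(\<Sum>u\<in>{- int R..int R}. mean_jump P u) = 1"
proof -
  interpret prob_space P using assms by (simp add: env_measure_def)
  have "integrable P (\<lambda>\<omega>. pmf (\<omega> (0, 0)) u)" for u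
    by (rule integrable_const_bound[where B = 1]) (auto simp: pmf_le_1 pmf_site_measurable[OF assms])
  then have "(\<Sum>u\<in>{- int R..int R}. mean_jump P u)
      = (\<integral>\<omega>. (\<Sum>u\<in>{- int R..int R}. pmf (\<omega> (0, 0)) u) \<partial>P)"
    unfolding mean_jump_def by (intro Bochner_Integration.integral_sum[symmetric]) auto
  also have "\<dots> = (\<integral>\<omega>. 1 \<partial>P)"
    by (intro Bochner_Integration.integral_cong refl sum_pmf_eq_1 site_support[OF assms]) auto
  finally show ?thesis by (simp add: prob_space)
qed

lemma infsum_mean_jump:
  fixes g :: "int \<Rightarrow> real"
  assumes "env_measure R P"
  shows "(\<Sum>\<^sub>\<infinity>u\<in>UNIV. g u * mean_jump P u) = (\<Sum>u\<in>{- int R..int R}. g u * mean_jump P u)"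
proof -
  have "(\<Sum>\<^sub>\<infinity>u\<in>UNIV. g u * mean_jump P u) = (\<Sum>\<^sub>\<infinity>u\<in>{- int R..int R}. g u * mean_jump P u)"
    by (rule infsum_cong_neutral) (auto simp: mean_jump_eq_0[OF assms])
  then show ?thesis by simp
qed

text \<open>An averaged jump law concentrated at one point is carried by a coset of the trivial subgroup,
  which (A3) excludes.\<close>

lemma mean_jump_neq_1:
  assumes "A3 P"
  shows "mean_jump P u \<noteq> 1"
proof
  assume "mean_jump P u = 1"
  then have "(\<Sum>\<^sub>\<infinity>z\<in>{0}. mean_jump P (u + z)) = 1"
    by simp
  moreover have "subgroup {0} integer_group"
    using group.triv_subgroup[OF group_integer_group] by simp
  moreover have "{0} \<noteq> (UNIV :: int set)"
    using infinite_UNIV_int by (metis finite.emptyI finite.insertI)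
  ultimately show False
    using assms unfolding A3_def by blast
qed

text \<open>The squared parameter is the variance of the averaged jump law. It could vanish only if all
  the mass sat at the velocity, that is, at a single integer.\<close>

lemma walk_sigma_pos:
  assumes "env_measure R P" "A3 P"
  shows "0 < walk_sigma P"
proof -
  let ?I = "{- int R..int R}" and ?p = "mean_jump P" and ?v = "velocity P"
  have v: "?v = (\<Sum>x\<in>?I. real_of_int x * ?p x)"
    unfolding velocity_def by (rule infsum_mean_jump[OF assms(1)])
  have "(\<Sum>x\<in>?I. (real_of_int x - ?v)\<^sup>2 * ?p x)
      = (\<Sum>x\<in>?I. (real_of_int x)\<^sup>2 * ?p x) - 2 * ?v * (\<Sum>x\<in>?I. real_of_int x * ?p x)
          + ?v\<^sup>2 * (\<Sum>x\<in>?I. ?p x)"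
    unfolding sum_distrib_left sum_subtractf[symmetric] sum.distrib[symmetric]
    by (intro sum.cong refl) (simp add: power2_eq_square algebra_simps)
  also have "\<dots> = (\<Sum>x\<in>?I. (real_of_int x)\<^sup>2 * ?p x) - ?v\<^sup>2"
    by (simp add: v[symmetric] sum_mean_jump[OF assms(1)] power2_eq_square)
  finally have sigma: "walk_sigma P = sqrt (\<Sum>x\<in>?I. (real_of_int x - ?v)\<^sup>2 * ?p x)"
    by (simp add: walk_sigma_def infsum_mean_jump[OF assms(1)])
  have "(\<Sum>x\<in>?I. (real_of_int x - ?v)\<^sup>2 * ?p x) \<noteq> 0"
  proof
    assume "(\<Sum>x\<in>?I. (real_of_int x - ?v)\<^sup>2 * ?p x) = 0"
    then have at_v: "real_of_int x = ?v \<or> ?p x = 0" if "x \<in> ?I" for x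
      using that by (subst (asm) sum_nonneg_eq_0_iff) (auto simp: mean_jump_nonneg)
    obtain u where u: "u \<in> ?I" "?p u \<noteq> 0"
      using sum_mean_jump[OF assms(1)] by (metis sum.neutral zero_neq_one)
    have "?p x = 0" if "x \<in> ?I - {u}" for x
      using at_v[OF u(1)] at_v[of x] u(2) that by auto
    then have "(\<Sum>x\<in>?I. ?p x) = ?p u"
      using u(1) by (subst sum.remove[of _ u]) auto
    then show False
      using sum_mean_jump[OF assms(1)] mean_jump_neq_1[OF assms(2), of u] by simp
  qed
  moreover have "0 \<le> (\<Sum>x\<in>?I. (real_of_int x - ?v)\<^sup>2 * ?p x)"
    by (intro sum_nonneg mult_nonneg_nonneg mean_jump_nonneg) auto
  ultimately have "0 < (\<Sum>x\<in>?I. (real_of_int x - ?v)\<^sup>2 * ?p x)"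
    by (metis order_le_neq_trans)
  then show ?thesis
    by (simp only: sigma real_sqrt_gt_zero)
qed


section \<open>The covariance at spatial parameter zero\<close>

text \<open>At \<open>x = 0\<close> the distribution function drops out of \<open>\<Psi>\<close>, and \<open>\<nu>\<^sup>2 \<phi>(0) = \<nu> / \<surd>(2\<pi>)\<close>. The
  separate convention for \<open>\<nu> = 0\<close> agrees with this formula.\<close>

lemma gauss_Psi_at_0:
  assumes "0 \<le> a" "0 \<le> \<sigma>"
  shows "gauss_Psi (\<sigma>\<^sup>2 * a) 0 = \<sigma> * sqrt a / sqrt (2 * pi)"
proof -
  have "gauss_Psi b 0 = sqrt b / sqrt (2 * pi)" if "0 \<le> b" for b
  proof (cases "b = 0")
    case False
    then have "gauss_Psi b 0 = b / (sqrt b * sqrt (2 * pi))"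
      using that by (simp add: gauss_Psi_def gauss_phi_def normal_density_def real_sqrt_mult mult_ac)
    also have "\<dots> = sqrt b / sqrt (2 * pi)"
      using real_div_sqrt[OF that] by (metis divide_divide_eq_left)
    finally show ?thesis .
  qed (simp add: gauss_Psi_def)
  from this[of "\<sigma>\<^sup>2 * a"] show ?thesis
    using assms by (simp add: real_sqrt_mult)
qed

text \<open>With equal parameters the terms in \<open>t + s\<close> of \<open>\<Gamma>\<^sub>1\<close> and \<open>\<Gamma>\<^sub>2\<close> cancel.\<close>

lemma current_covariance_equal_parameters:
  assumes "0 \<le> s" "0 \<le> t" "0 \<le> \<sigma>"
  shows "current_covariance \<rho> \<rho> \<sigma> (s, 0) (t, 0)
    = \<rho> * \<sigma> / sqrt (2 * pi) * (sqrt s + sqrt t - sqrt \<bar>t - s\<bar>)"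
proof -
  have "current_covariance \<rho> \<rho> \<sigma> (s, 0) (t, 0)
      = \<rho> * (gauss_Psi (\<sigma>\<^sup>2 * s) 0 + gauss_Psi (\<sigma>\<^sup>2 * t) 0 - gauss_Psi (\<sigma>\<^sup>2 * \<bar>t - s\<bar>) 0)"
    by (simp add: current_covariance_def Gamma1_def Gamma2_def algebra_simps)
  also have "\<dots> = \<rho> * \<sigma> / sqrt (2 * pi) * (sqrt s + sqrt t - sqrt \<bar>t - s\<bar>)"
    using assms by (simp only: gauss_Psi_at_0 abs_ge_zero) (simp add: algebra_simps add_divide_distrib diff_divide_distrib)
  finally show ?thesis .
qed

lemma gaussian_process_reindex_scale:
  fixes k :: real
  assumes "gaussian_process M T X" "h ` S \<subseteq> T" "inj_on h S"
  shows "gaussian_process M S (\<lambda>i w. k * X (h i) w)"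
  unfolding gaussian_process_def
proof (intro conjI ballI allI impI)
  show "prob_space M"
    using assms(1) by (simp add: gaussian_process_def)
  show "(\<lambda>w. k * X (h i) w) \<in> borel_measurable M" if "i \<in> S" for i
  proof -
    have "X (h i) \<in> borel_measurable M"
      using assms(1,2) that unfolding gaussian_process_def by blast
    then show ?thesis by measurable
  qed
  fix F and c :: "'c \<Rightarrow> real"
  assume F: "finite F \<and> F \<subseteq> S"
  \<comment> \<open>A combination of the new variables is one of the old variables: injectivity of \<open>h\<close>
    lets the coefficients be transported to the image of \<open>F\<close>.\<close>
  let ?c = "\<lambda>j. c (the_inv_into F h j) * k"
  have inj: "inj_on h F"
    using assms(3) F by (auto intro: inj_on_subset)
  have sum: "(\<Sum>j\<in>h ` F. ?c j * X j w) = (\<Sum>i\<in>F. c i * (k * X (h i) w))" for w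
    by (subst sum.reindex[OF inj]) (simp add: the_inv_into_f_f[OF inj] mult.assoc)
  have "finite (h ` F) \<and> h ` F \<subseteq> T"
    using F assms(2) by auto
  moreover have "\<forall>F c. finite F \<and> F \<subseteq> T \<longrightarrow>
      (\<exists>m s. 0 \<le> s \<and> distr M borel (\<lambda>w. \<Sum>i\<in>F. c i * X i w) = gaussian_law m s)"
    using assms(1) unfolding gaussian_process_def by (elim conjE)
  ultimately have "\<exists>m s. 0 \<le> s \<and> distr M borel (\<lambda>w. \<Sum>j\<in>h ` F. ?c j * X j w) = gaussian_law m s"
    by (elim allE[of _ "h ` F"] allE[of _ ?c] impE)
  then show "\<exists>m s. 0 \<le> s \<and> distr M borel (\<lambda>w. \<Sum>i\<in>F. c i * (k * X (h i) w)) = gaussian_law m s"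
    by (simp only: sum)
qed

lemma centered_gaussian_process_reindex_scale:
  fixes k :: real
  assumes "centered_gaussian_process M T K X" "h ` S \<subseteq> T" "inj_on h S"
    and cov: "\<And>i j. i \<in> S \<Longrightarrow> j \<in> S \<Longrightarrow> K' i j = k\<^sup>2 * K (h i) (h j)"
  shows "centered_gaussian_process M S K' (\<lambda>i w. k * X (h i) w)"
proof -
  have "(\<integral>w. (k * X (h i) w) * (k * X (h j) w) \<partial>M) = k\<^sup>2 * (\<integral>w. X (h i) w * X (h j) w \<partial>M)" for i j
    unfolding integral_mult_right_zero[symmetric]
    by (rule Bochner_Integration.integral_cong) (auto simp: power2_eq_square)
  then show ?thesis
    using assms(1,2) cov gaussian_process_reindex_scale[OF _ assms(2,3), of M X k]
    by (simp add: centered_gaussian_process_def image_subset_iff)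
qed

theorem corollary1p5:
  fixes R :: nat
    and P :: "environment measure"
    and \<mu> :: "environment \<Rightarrow> int \<Rightarrow> nat pmf"
    and M :: "'w measure"
    and Z :: "real \<times> real \<Rightarrow> 'w \<Rightarrow> real"
  assumes "env_measure R P"
    and "A1 R P" and "A2 P" and "A3 P"
    and "B1 R \<mu>" and "B2 P \<mu>"
    and "centered_gaussian_process M ({0..} \<times> UNIV)
           (current_covariance (rho0 P \<mu>) (sigma0_sq P \<mu>) (walk_sigma P)) Z"
  shows "((AE \<omega> in P. occupation_law \<mu> \<omega> = poisson_occupation_law (rho0 P \<mu>) \<omega>)
            \<longrightarrow> sigma0_sq P \<mu> = rho0 P \<mu>) \<and>
         (sigma0_sq P \<mu> = rho0 P \<mu> \<longrightarrow>
            (\<forall>s\<ge>0. \<forall>t\<ge>0. (\<integral>w. Z (s, 0) w * Z (t, 0) w \<partial>M) =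
               rho0 P \<mu> * walk_sigma P / sqrt (2 * pi) * (sqrt s + sqrt t - sqrt \<bar>t - s\<bar>)) \<and>
            (rho0 P \<mu> > 0 \<longrightarrow>
               fractional_brownian_motion (1 / 4) M
                 (\<lambda>t w. sqrt (inverse (rho0 P \<mu>) * inverse (walk_sigma P) * sqrt (pi / 2)) * Z (t, 0) w)))"
proof -
  let ?\<rho> = "rho0 P \<mu>" and ?\<sigma> = "walk_sigma P"
  let ?k = "sqrt (inverse ?\<rho> * inverse ?\<sigma> * sqrt (pi / 2))"
  have \<sigma>: "0 < ?\<sigma>"
    using assms(1,4) by (rule walk_sigma_pos)
  have cov: "current_covariance ?\<rho> (sigma0_sq P \<mu>) ?\<sigma> (s, 0) (t, 0)
      = ?\<rho> * ?\<sigma> / sqrt (2 * pi) * (sqrt s + sqrt t - sqrt \<bar>t - s\<bar>)"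
    if "sigma0_sq P \<mu> = ?\<rho>" "0 \<le> s" "0 \<le> t" for s t
    using current_covariance_equal_parameters[of s t ?\<sigma> ?\<rho>] that \<sigma> by simp
  have "fractional_brownian_motion (1 / 4) M (\<lambda>t w. ?k * Z (t, 0) w)"
    if eq: "sigma0_sq P \<mu> = ?\<rho>" and \<rho>: "0 < ?\<rho>"
    unfolding fractional_brownian_motion_def
  proof (rule centered_gaussian_process_reindex_scale[OF assms(7), where h = "\<lambda>t. (t, 0)"])
    fix s t :: real
    assume st: "s \<in> {0..}" "t \<in> {0..}"
    \<comment> \<open>The normalising constant is chosen so that the prefactor of the covariance becomes
      one half.\<close>
    have "sqrt (pi / 2) / sqrt (2 * pi) = 1 / 2"
      by (simp add: real_sqrt_divide real_sqrt_mult)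
    moreover have "?k\<^sup>2 = inverse ?\<rho> * inverse ?\<sigma> * sqrt (pi / 2)"
      using \<rho> \<sigma> by simp
    ultimately have "?k\<^sup>2 * (?\<rho> * ?\<sigma> / sqrt (2 * pi)) = 1 / 2"
      using \<rho> \<sigma> by (simp add: field_simps)
    then have "?k\<^sup>2 * current_covariance ?\<rho> (sigma0_sq P \<mu>) ?\<sigma> (s, 0) (t, 0)
        = 1 / 2 * (sqrt s + sqrt t - sqrt \<bar>t - s\<bar>)"
      using st by (simp only: cov[OF eq] atLeast_iff mult.assoc[symmetric])
    then show "(s powr (2 * (1 / 4)) + t powr (2 * (1 / 4)) - \<bar>t - s\<bar> powr (2 * (1 / 4))) / 2
        = ?k\<^sup>2 * current_covariance ?\<rho> (sigma0_sq P \<mu>) ?\<sigma> (s, 0) (t, 0)"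
      using st by (simp add: powr_half_sqrt)
  qed (auto simp: inj_on_def)
  moreover have "(\<integral>w. Z (s, 0) w * Z (t, 0) w \<partial>M)
      = ?\<rho> * ?\<sigma> / sqrt (2 * pi) * (sqrt s + sqrt t - sqrt \<bar>t - s\<bar>)"
    if "sigma0_sq P \<mu> = ?\<rho>" "0 \<le> s" "0 \<le> t" for s t
    using assms(7) that cov[OF that] by (simp add: centered_gaussian_process_def)
  moreover have "sigma0_sq P \<mu> = ?\<rho>"
    if "AE \<omega> in P. occupation_law \<mu> \<omega> = poisson_occupation_law ?\<rho> \<omega>"
    using assms(1,5) that by (rule sigma0_sq_eq_rho0_if_poisson)
  ultimately show ?thesis
    by blast
qed

end
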